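(* For every bandit instance, every initial distribution $\tilde\pi_0$ and every tolerance $\epsilon>0$, the algorithm RLP Solver described in the context produces a feasible solution $\pi^{\rm RLP}$ of $RLP(\tilde\pi_0)$ whose objective value is at least $OPT(RLP(\tilde\pi_0))-2\epsilon$.
   Context: **Bandit model.** Integers $n\ge1$, $1\le k\le n$, $T\ge1$. Arm $i\in\{1,\dots,n\}$ is a Markov decision process with finite state space $\mathcal S_i$, finite action space $\mathcal A_i$, reward $r_i:\mathcal S_i\times\mathcal A_i\to\mathbb R_+$ (nonnegative reals) and transition kernel $P_i(s_i,a_i,s_i')$. Each $\mathcal A_i$ contains an idle action $\phi_i$ with $r_i(s_i,\phi_i)=0$ and $P_i(s_i,\phi_i,s_i)=1$ for all $s_i$. $\tilde\pi_0$ is a probability distribution on $\mathcal S=\prod_i\mathcal S_i$. Times are $t\in\{0,\dots,T-1\}$. **Arm polytopes.** $D_i(\tilde\pi_0)\subset\mathbb R^{|\mathcal S_i||\mathcal A_i|T}$ is the set of $\pi_i=(\pi_i(s_i,a_i,t))\ge0$ with $\sum_{a_i}\pi_i(s_i,a_i,t)=\sum_{s_i',a_i'}P_i(s_i',a_i',s_i)\pi_i(s_i',a_i',t-1)$ for all $s_i$, $t>0$, and $\sum_{a_i}\pi_i(s_i,a_i,0)=\sum_{\bar s:\bar s_i=s_i}\tilde\pi_0(\bar s)$ for all $s_i$. For $\pi_i\in D_i(\tilde\pi_0)$ let $R_i(\pi_i)=\sum_t\sum_{s_i,a_i}\pi_i(s_i,a_i,t)r_i(s_i,a_i)$ and $T_i(\pi_i)=T-\sum_{s_i}\sum_t\pi_i(s_i,\phi_i,t)$.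 **$RLP(\tilde\pi_0)$**: maximize $\sum_iR_i(\pi_i)$ over $\pi_i\in D_i(\tilde\pi_0)$, $i=1,\dots,n$, subject to $\sum_iT_i(\pi_i)\le kT$. $OPT(\cdot)$ denotes optimal value. **RLP Solver** (input: bandit, $\tilde\pi_0$, $\epsilon>0$). Let $r_{\max}=\max_{i,s_i,a_i}r_i(s_i,a_i)$; all maximizations are over $\pi_i\in D_i(\tilde\pi_0)$, and any maximizer may be selected. 1. Set $\lambda^{\rm feas}=r_{\max}+\delta$ for any $\delta>0$, and $\lambda^{\rm infeas}=0$. For all $i$ choose $\pi_i^{\rm feas}\in\arg\max_{\pi_i}(R_i(\pi_i)-\lambda^{\rm feas}T_i(\pi_i))$ and $\pi_i^{\rm infeas}\in\arg\max_{\pi_i}(R_i(\pi_i)-\lambda^{\rm infeas}T_i(\pi_i))$. 2. While $\lambda^{\rm feas}-\lambda^{\rm infeas}>\epsilon/(kT)$: set $\lambda=(\lambda^{\rm feas}+\lambda^{\rm infeas})/2$; for all $i$ choose $\pi_i^*\in\arg\max_{\pi_i}(R_i(\pi_i)-\lambda T_i(\pi_i))$; if $\sum_iT_i(\pi_i^* )>kT$ set $\lambda^{\rm infeas}=\lambda$ and $\pi_i^{\rm infeas}=\pi_i^*$ for all $i$; otherwise set $\lambda^{\rm feas}=\lambda$ and $\pi_i^{\rm feas}=\pi_i^*$ for all $i$. 3. If $\sum_i(T_i(\pi_i^{\rm infeas})-T_i(\pi_i^{\rm feas}))>0$, set $\alpha=\min\Big(\dfrac{kT-\sum_iT_i(\pi_i^{\rm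 feas})}{\sum_i(T_i(\pi_i^{\rm infeas})-T_i(\pi_i^{\rm feas}))},\,1\Big)$; otherwise set $\alpha=0$. 4. Output $\pi_i^{\rm RLP}=\alpha\pi_i^{\rm infeas}+(1-\alpha)\pi_i^{\rm feas}$ for $i=1,\dots,n$. *)

theory Defs
  imports "HOL-Probability.Probability"
begin

section \<open>Bandit instances\<close>

text \<open>
  Arms are numbered \<open>1..n\<close>. The state and action spaces of the arms are arbitrary finite
  subsets of two common carrier types; the kernel \<open>P\<^sub>i(s, a, s')\<close> is \<open>pmf (kernel B i s a) s'\<close>.
  The components of the record are only meaningful for arms, states and actions of the instance.
\<close>

record ('s, 'a) bandit =
  num_arms :: nat
  num_active :: nat
  horizon :: nat
  states :: "nat \<Rightarrow> 's set"
  actions :: "nat \<Rightarrow> 'a set"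
  idle :: "nat \<Rightarrow> 'a"
  reward :: "nat \<Rightarrow> 's \<Rightarrow> 'a \<Rightarrow> real"
  kernel :: "nat \<Rightarrow> 's \<Rightarrow> 'a \<Rightarrow> 's pmf"

definition arms :: "('s, 'a) bandit \<Rightarrow> nat set" where
  "arms B = {1..num_arms B}"

definition bandit_instance :: "('s, 'a) bandit \<Rightarrow> bool" where
  "bandit_instance B \<longleftrightarrow>
     1 \<le> num_arms B \<and> 1 \<le> num_active B \<and> num_active B \<le> num_arms B \<and> 1 \<le> horizon B \<and>
     (\<forall>i\<in>arms B.
        finite (states B i) \<and> finite (actions B i) \<and>
        (\<forall>s\<in>states B i. \<forall>a\<in>actions B i.
           0 \<le> reward B i s a \<and> set_pmf (kernel B i s a) \<subseteq> states B i) \<and>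
        idle B i \<in> actions B i \<and>
        (\<forall>s\<in>states B i. reward B i s (idle B i) = 0 \<and> pmf (kernel B i s (idle B i)) s = 1))"

definition joint_states :: "('s, 'a) bandit \<Rightarrow> (nat \<Rightarrow> 's) set" where
  "joint_states B = PiE (arms B) (states B)"

definition initial_distribution :: "('s, 'a) bandit \<Rightarrow> (nat \<Rightarrow> 's) pmf \<Rightarrow> bool" where
  "initial_distribution B \<mu> \<longleftrightarrow> set_pmf \<mu> \<subseteq> joint_states B"

section \<open>Arm polytopes and the relaxed linear program\<close>

type_synonym ('s, 'a) arm_policy = "'s \<Rightarrow> 'a \<Rightarrow> nat \<Rightarrow> real"

text \<open>
  A vector indexed by \<open>states B i \<times> actions B i \<times> {0..<horizon B}\<close> is represented by a function
  that vanishes outside this index set.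
\<close>

definition arm_polytope ::
    "('s, 'a) bandit \<Rightarrow> (nat \<Rightarrow> 's) pmf \<Rightarrow> nat \<Rightarrow> ('s, 'a) arm_policy set" where
  "arm_polytope B \<mu> i = {x.
     (\<forall>s a t. s \<notin> states B i \<or> a \<notin> actions B i \<or> t \<ge> horizon B \<longrightarrow> x s a t = 0) \<and>
     (\<forall>s\<in>states B i. \<forall>a\<in>actions B i. \<forall>t<horizon B. 0 \<le> x s a t) \<and>
     (\<forall>s\<in>states B i. \<forall>t\<in>{1..<horizon B}.
        (\<Sum>a\<in>actions B i. x s a t) =
        (\<Sum>s'\<in>states B i. \<Sum>a'\<in>actions B i. pmf (kernel B i s' a') s * x s' a' (t - 1))) \<and>
     (\<forall>s\<in>states B i.
        (\<Sum>a\<in>actions B i. x s a 0) = (\<Sum>s'\<in>{s'\<in>joint_states B. s' i = s}. pmf \<mu> s'))}"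

definition arm_reward :: "('s, 'a) bandit \<Rightarrow> nat \<Rightarrow> ('s, 'a) arm_policy \<Rightarrow> real" where
  "arm_reward B i x =
     (\<Sum>t<horizon B. \<Sum>s\<in>states B i. \<Sum>a\<in>actions B i. x s a t * reward B i s a)"

definition arm_active_time :: "('s, 'a) bandit \<Rightarrow> nat \<Rightarrow> ('s, 'a) arm_policy \<Rightarrow> real" where
  "arm_active_time B i x =
     real (horizon B) - (\<Sum>s\<in>states B i. \<Sum>t<horizon B. x s (idle B i) t)"

type_synonym ('s, 'a) policy = "nat \<Rightarrow> ('s, 'a) arm_policy"

definition total_reward :: "('s, 'a) bandit \<Rightarrow> ('s, 'a) policy \<Rightarrow> real" where
  "total_reward B \<pi> = (\<Sum>i\<in>arms B. arm_reward B i (\<pi> i))"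

definition total_active_time :: "('s, 'a) bandit \<Rightarrow> ('s, 'a) policy \<Rightarrow> real" where
  "total_active_time B \<pi> = (\<Sum>i\<in>arms B. arm_active_time B i (\<pi> i))"

definition budget :: "('s, 'a) bandit \<Rightarrow> real" where
  "budget B = real (num_active B) * real (horizon B)"

definition rlp_feasible ::
    "('s, 'a) bandit \<Rightarrow> (nat \<Rightarrow> 's) pmf \<Rightarrow> ('s, 'a) policy \<Rightarrow> bool" where
  "rlp_feasible B \<mu> \<pi> \<longleftrightarrow>
     (\<forall>i\<in>arms B. \<pi> i \<in> arm_polytope B \<mu> i) \<and> total_active_time B \<pi> \<le> budget B"

text \<open>
  The optimal value is a supremum in the extended reals, so that it carries no convention for
  an empty or unbounded set of objective values.
\<close>

definition rlp_opt :: "('s, 'a) bandit \<Rightarrow> (nat \<Rightarrow> 's) pmf \<Rightarrow> ereal" where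
  "rlp_opt B \<mu> = (SUP \<pi>\<in>{\<pi>. rlp_feasible B \<mu> \<pi>}. ereal (total_reward B \<pi>))"

section \<open>The RLP solver\<close>

definition max_reward :: "('s, 'a) bandit \<Rightarrow> real" where
  "max_reward B = Max {reward B i s a | i s a. i \<in> arms B \<and> s \<in> states B i \<and> a \<in> actions B i}"

definition lagrangian_maximizer ::
    "('s, 'a) bandit \<Rightarrow> (nat \<Rightarrow> 's) pmf \<Rightarrow> real \<Rightarrow> ('s, 'a) policy \<Rightarrow> bool" where
  "lagrangian_maximizer B \<mu> l \<pi> \<longleftrightarrow>
     (\<forall>i\<in>arms B. is_arg_max (\<lambda>x. arm_reward B i x - l * arm_active_time B i x)
                  (\<lambda>x. x \<in> arm_polytope B \<mu> i) (\<pi> i))"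

text \<open>
  The solver is nondeterministic: it may pick any \<open>\<delta> > 0\<close> and, in every round, any maximizers.
  It is therefore modelled as a transition relation on the values of its variables.
\<close>

record ('s, 'a) solver_state =
  lam_feas :: real
  lam_infeas :: real
  pol_feas :: "('s, 'a) policy"
  pol_infeas :: "('s, 'a) policy"

definition solver_init ::
    "('s, 'a) bandit \<Rightarrow> (nat \<Rightarrow> 's) pmf \<Rightarrow> real \<Rightarrow> ('s, 'a) solver_state \<Rightarrow> bool" where
  "solver_init B \<mu> \<delta> \<sigma> \<longleftrightarrow>
     lam_feas \<sigma> = max_reward B + \<delta> \<and> lam_infeas \<sigma> = 0 \<and>
     lagrangian_maximizer B \<mu> (lam_feas \<sigma>) (pol_feas \<sigma>) \<and>
     lagrangian_maximizer B \<mu> (lam_infeas \<sigma>) (pol_infeas \<sigma>)"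

definition solver_guard :: "('s, 'a) bandit \<Rightarrow> real \<Rightarrow> ('s, 'a) solver_state \<Rightarrow> bool" where
  "solver_guard B \<epsilon> \<sigma> \<longleftrightarrow> lam_feas \<sigma> - lam_infeas \<sigma> > \<epsilon> / budget B"

definition solver_step ::
    "('s, 'a) bandit \<Rightarrow> (nat \<Rightarrow> 's) pmf \<Rightarrow> real \<Rightarrow>
     ('s, 'a) solver_state \<Rightarrow> ('s, 'a) solver_state \<Rightarrow> bool" where
  "solver_step B \<mu> \<epsilon> \<sigma> \<sigma>' \<longleftrightarrow>
     solver_guard B \<epsilon> \<sigma> \<and>
     (\<exists>l \<pi>. l = (lam_feas \<sigma> + lam_infeas \<sigma>) / 2 \<and>
            lagrangian_maximizer B \<mu> l \<pi> \<and>
            \<sigma>' = (if total_active_time B \<pi> > budget B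
                  then \<sigma>\<lparr>lam_infeas := l, pol_infeas := \<pi>\<rparr>
                  else \<sigma>\<lparr>lam_feas := l, pol_feas := \<pi>\<rparr>))"

definition solver_weight :: "('s, 'a) bandit \<Rightarrow> ('s, 'a) solver_state \<Rightarrow> real" where
  "solver_weight B \<sigma> =
     (let d = (\<Sum>i\<in>arms B. arm_active_time B i (pol_infeas \<sigma> i) - arm_active_time B i (pol_feas \<sigma> i))
      in if d > 0 then min ((budget B - total_active_time B (pol_feas \<sigma>)) / d) 1 else 0)"

definition solver_output :: "('s, 'a) bandit \<Rightarrow> ('s, 'a) solver_state \<Rightarrow> ('s, 'a) policy" where
  "solver_output B \<sigma> =
     (\<lambda>i s a t. solver_weight B \<sigma> * pol_infeas \<sigma> i s a t
              + (1 - solver_weight B \<sigma>) * pol_feas \<sigma> i s a t)"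

definition solver_reachable ::
    "('s, 'a) bandit \<Rightarrow> (nat \<Rightarrow> 's) pmf \<Rightarrow> real \<Rightarrow> ('s, 'a) solver_state \<Rightarrow> bool" where
  "solver_reachable B \<mu> \<epsilon> \<sigma> \<longleftrightarrow>
     (\<exists>\<delta>>0. \<exists>\<sigma>\<^sub>0. solver_init B \<mu> \<delta> \<sigma>\<^sub>0 \<and> (solver_step B \<mu> \<epsilon>)\<^sup>*\<^sup>* \<sigma>\<^sub>0 \<sigma>)"

text \<open>
  Every run of the solver produces an output: the initialization is possible for every
  \<open>\<delta> > 0\<close>, the loop body can be executed whenever the loop is entered, and no run is infinite.
\<close>

definition solver_terminates :: "('s, 'a) bandit \<Rightarrow> (nat \<Rightarrow> 's) pmf \<Rightarrow> real \<Rightarrow> bool" where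
  "solver_terminates B \<mu> \<epsilon> \<longleftrightarrow>
     (\<forall>\<delta>>0. \<exists>\<sigma>. solver_init B \<mu> \<delta> \<sigma>) \<and>
     (\<forall>\<sigma>. solver_reachable B \<mu> \<epsilon> \<sigma> \<and> solver_guard B \<epsilon> \<sigma> \<longrightarrow> (\<exists>\<sigma>'. solver_step B \<mu> \<epsilon> \<sigma> \<sigma>')) \<and>
     \<not> (\<exists>f. (\<exists>\<delta>>0. solver_init B \<mu> \<delta> (f 0)) \<and> (\<forall>m::nat. solver_step B \<mu> \<epsilon> (f m) (f (Suc m))))"

definition solver_result ::
    "('s, 'a) bandit \<Rightarrow> (nat \<Rightarrow> 's) pmf \<Rightarrow> real \<Rightarrow> ('s, 'a) policy \<Rightarrow> bool" where
  "solver_result B \<mu> \<epsilon> \<pi> \<longleftrightarrow>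
     (\<exists>\<sigma>. solver_reachable B \<mu> \<epsilon> \<sigma> \<and> \<not> solver_guard B \<epsilon> \<sigma> \<and> \<pi> = solver_output B \<sigma>)"

end

theory Submission
  imports Defs
begin

text \<open>
  Write \<open>g(\<lambda>) = max (R - \<lambda> T)\<close> for the Lagrangian of the linear program in which the
  activation budget \<open>b = k T\<close> is priced at \<open>\<lambda> \<ge> 0\<close>. Every feasible policy earns at most
  \<open>g(\<lambda>) + \<lambda> b\<close>, so a maximizer \<open>\<pi>\<close> of the Lagrangian falls short of the optimum by at most
  \<open>\<lambda> (b - T(\<pi>))\<close>. The bisection keeps two prices, each with a maximizer: at the upper price
  the maximizer respects the budget, at the lower price it overspends unless that price is
  still zero. If the final mixture of the two maximizers spends exactly \<open>b\<close>, the two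
  shortfalls cancel up to the difference of the prices, which leaves a loss of at most
  \<open>(\<lambda>_feas - \<lambda>_infeas) b \<le> \<epsilon>\<close>. If it does not spend the whole budget, the lower price is zero,
  and then either the mixture is the unconstrained maximizer or the upper price alone bounds
  the loss (\<open>interpolation_loss\<close>). Hence the solver is even \<open>\<epsilon>\<close>-optimal.

  Three further points make the algorithm well defined. The arm polytope consists of flows
  of total mass one in every period, so it is a compact subset of a product of unit intervals
  and linear objectives attain their maximum on it (\<open>compact_arm_polytope\<close>,
  \<open>ex_lagrangian_maximizer\<close>). At a price above every reward only idling is optimal, so the
  initial upper policy respects the budget (\<open>bracketing_init\<close>). The distance of the prices
  halves in every round, so it drops below any positive tolerance
  (\<open>no_infinite_run\<close>).
\<close>

section \<open>Mixing two Lagrangian maximizers\<close>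

text \<open>
  Here \<open>v\<close> is the value of some policy within budget \<open>b\<close>, and the indices \<open>f\<close> and \<open>h\<close> stand
  for the maximizers at the upper and at the lower price.
  When the mixture exhausts the budget, \<open>w * (b - Ah) = - (1 - w) * (b - Af)\<close>, so that the
  combined loss is \<open>(lf - lh) * (1 - w) * (b - Af)\<close>.
\<close>

lemma interpolation_loss:
  fixes Af Ah Rf Rh lf lh b v w e :: real
  assumes Af: "0 \<le> Af" "Af \<le> b"
    and l: "0 \<le> lh" "lh \<le> lf" "(lf - lh) * b \<le> e"
    and tight: "lh = 0 \<or> b < Ah"
    and vf: "v - lf * b \<le> Rf - lf * Af"
    and vh: "v - lh * b \<le> Rh - lh * Ah"
    and w: "w = (if Ah - Af > 0 then min ((b - Af) / (Ah - Af)) 1 else 0)"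
  shows "0 \<le> w" "w \<le> 1" "w * Ah + (1 - w) * Af \<le> b" "v - e \<le> w * Rh + (1 - w) * Rf"
proof -
  show w0: "0 \<le> w" and w1: "w \<le> 1"
    using Af w by auto
  have e0: "0 \<le> e"
    using l Af mult_nonneg_nonneg[of "lf - lh" b] by linarith
  have loss: "v - (w * (lh * (b - Ah)) + (1 - w) * (lf * (b - Af))) \<le> w * Rh + (1 - w) * Rf"
  proof -
    have "w * (v - lh * (b - Ah)) \<le> w * Rh"
      by (rule mult_left_mono) (use vh w0 in \<open>auto simp: algebra_simps\<close>)
    moreover have "(1 - w) * (v - lf * (b - Af)) \<le> (1 - w) * Rf"
      by (rule mult_left_mono) (use vf w1 in \<open>auto simp: algebra_simps\<close>)
    ultimately show ?thesis
      by (simp add: algebra_simps)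
  qed
  have gap: "(lf - lh) * (u * (b - Af)) \<le> e" if "0 \<le> u" "u \<le> 1" for u
  proof -
    have "u * (b - Af) \<le> 1 * b"
      using that Af by (intro mult_mono) auto
    then have "(lf - lh) * (u * (b - Af)) \<le> (lf - lh) * b"
      using l by (intro mult_left_mono) auto
    then show ?thesis using l by linarith
  qed
  consider (idle) "Ah \<le> Af" | (exact) "Ah > Af" "(b - Af) / (Ah - Af) \<le> 1"
    | (slack) "Ah > Af" "(b - Af) / (Ah - Af) > 1"
    by linarith
  then have "w * Ah + (1 - w) * Af \<le> b \<and> v - e \<le> w * Rh + (1 - w) * Rf"
  proof cases
    case idle
    then have "w = 0" "lh = 0" using w tight Af by auto
    then show ?thesis using loss gap[of 1] Af by simp
  next
    case exact
    then have weq: "w = (b - Af) / (Ah - Af)" using w by auto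
    then have "w * (Ah - Af) = b - Af" using exact by simp
    then have bal: "w * Ah + (1 - w) * Af = b" by (simp add: algebra_simps)
    then have "w * (b - Ah) = - ((1 - w) * (b - Af))" by (simp add: algebra_simps)
    then have "w * (lh * (b - Ah)) = - (lh * ((1 - w) * (b - Af)))"
      by (metis mult.left_commute mult_minus_right)
    then have "w * (lh * (b - Ah)) + (1 - w) * (lf * (b - Af)) = (lf - lh) * ((1 - w) * (b - Af))"
      by (simp add: algebra_simps)
    then show ?thesis using loss gap[of "1 - w"] w0 w1 bal by simp
  next
    case slack
    then have "w = 1" "Ah < b" using w by (auto simp: field_simps)
    then show ?thesis using loss tight e0 by auto
  qed
  then show "w * Ah + (1 - w) * Af \<le> b" "v - e \<le> w * Rh + (1 - w) * Rf"
    by blast+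
qed

definition mix :: "real \<Rightarrow> ('s, 'a) arm_policy \<Rightarrow> ('s, 'a) arm_policy \<Rightarrow> ('s, 'a) arm_policy" where
  "mix w x y = (\<lambda>s a t. w * x s a t + (1 - w) * y s a t)"

lemma arm_reward_mix:
  "arm_reward B i (mix w x y) = w * arm_reward B i x + (1 - w) * arm_reward B i y"
  unfolding arm_reward_def mix_def
  by (simp add: distrib_right sum.distrib sum_distrib_left mult.assoc)

lemma arm_active_time_mix:
  "arm_active_time B i (mix w x y) = w * arm_active_time B i x + (1 - w) * arm_active_time B i y"
  unfolding arm_active_time_def mix_def sum.distrib sum_distrib_left[symmetric]
  by (simp add: algebra_simps)

lemma mix_in_arm_polytope:
  assumes x: "x \<in> arm_polytope B \<mu> i" and y: "y \<in> arm_polytope B \<mu> i" and w: "0 \<le> w" "w \<le> 1"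
  shows "mix w x y \<in> arm_polytope B \<mu> i"
  unfolding arm_polytope_def
proof (intro CollectI conjI ballI allI impI)
  fix s a t assume "s \<notin> states B i \<or> a \<notin> actions B i \<or> t \<ge> horizon B"
  then show "mix w x y s a t = 0"
    using x y unfolding mix_def arm_polytope_def by auto
next
  fix s a t assume "s \<in> states B i" "a \<in> actions B i" "t < horizon B"
  then show "0 \<le> mix w x y s a t"
    using x y w unfolding mix_def arm_polytope_def by auto
next
  fix s t assume "s \<in> states B i" "t \<in> {1..<horizon B}"
  then show "(\<Sum>a\<in>actions B i. mix w x y s a t) =
      (\<Sum>s'\<in>states B i. \<Sum>a'\<in>actions B i. pmf (kernel B i s' a') s * mix w x y s' a' (t - 1))"
    using x y unfolding mix_def arm_polytope_def
    by (simp add: distrib_left sum.distrib sum_distrib_left[symmetric] mult.left_commute)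
next
  fix s assume "s \<in> states B i"
  then have "(\<Sum>a\<in>actions B i. x s a 0) = (\<Sum>s'\<in>{s'\<in>joint_states B. s' i = s}. pmf \<mu> s')"
    "(\<Sum>a\<in>actions B i. y s a 0) = (\<Sum>s'\<in>{s'\<in>joint_states B. s' i = s}. pmf \<mu> s')"
    using x y unfolding arm_polytope_def by blast+
  then show "(\<Sum>a\<in>actions B i. mix w x y s a 0) = (\<Sum>s'\<in>{s'\<in>joint_states B. s' i = s}. pmf \<mu> s')"
    unfolding mix_def sum.distrib sum_distrib_left[symmetric] by (simp add: algebra_simps)
qed

section \<open>Arm polytopes as flows of unit mass\<close>

lemma compact_functions_into:
  fixes K :: "'b :: topological_space set"
  assumes "compact K"
  shows "compact {f :: 'i \<Rightarrow> 'b. \<forall>j. f j \<in> K}"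
  using assms compactin_PiE[of "\<lambda>_. euclidean" "UNIV :: 'i set" "\<lambda>_. K"]
  by (simp add: euclidean_product_topology PiE_UNIV_domain Pi_def)

locale rlp_instance =
  fixes B :: "('s, 'a) bandit" and \<mu> :: "(nat \<Rightarrow> 's) pmf"
  assumes instance_B: "bandit_instance B" and initial_\<mu>: "initial_distribution B \<mu>"
begin

lemma finite_arms: "finite (arms B)"
  unfolding arms_def by simp

lemma arm_facts:
  assumes "i \<in> arms B"
  shows "finite (states B i)" "finite (actions B i)" "idle B i \<in> actions B i"
    and "\<And>s. s \<in> states B i \<Longrightarrow> reward B i s (idle B i) = 0"
    and "\<And>s a. s \<in> states B i \<Longrightarrow> a \<in> actions B i \<Longrightarrow> set_pmf (kernel B i s a) \<subseteq> states B i"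
    and "\<And>s. s \<in> states B i \<Longrightarrow> pmf (kernel B i s (idle B i)) s = 1"
  using assms instance_B unfolding bandit_instance_def by auto

lemma budget_pos: "0 < budget B"
  using instance_B unfolding bandit_instance_def budget_def by simp

lemma arm_initial_mass:
  assumes "i \<in> arms B"
  shows "(\<Sum>s\<in>states B i. \<Sum>s'\<in>{s'\<in>joint_states B. s' i = s}. pmf \<mu> s') = 1"
proof -
  have fin: "finite (joint_states B)"
    unfolding joint_states_def by (intro finite_PiE finite_arms arm_facts)
  have "(\<Sum>s\<in>states B i. \<Sum>s'\<in>{s'\<in>joint_states B. s' i = s}. pmf \<mu> s') = (\<Sum>s'\<in>joint_states B. pmf \<mu> s')"
    by (rule sum.group) (use fin assms arm_facts in \<open>auto simp: joint_states_def\<close>)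
  also have "\<dots> = 1"
    using fin initial_\<mu> unfolding initial_distribution_def by (intro sum_pmf_eq_1) auto
  finally show ?thesis .
qed

text \<open>The transition kernels only redistribute mass among the states of the arm.\<close>

lemma arm_polytope_mass:
  assumes i: "i \<in> arms B" and x: "x \<in> arm_polytope B \<mu> i" and t: "t < horizon B"
  shows "(\<Sum>s\<in>states B i. \<Sum>a\<in>actions B i. x s a t) = 1"
  using t
proof (induction t)
  case 0
  have "(\<Sum>s\<in>states B i. \<Sum>a\<in>actions B i. x s a 0)
      = (\<Sum>s\<in>states B i. \<Sum>s'\<in>{s'\<in>joint_states B. s' i = s}. pmf \<mu> s')"
    using x unfolding arm_polytope_def by (intro sum.cong) auto
  then show ?case using arm_initial_mass[OF i] by simp
next
  case (Suc t)
  let ?S = "states B i" and ?A = "actions B i"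
  have "(\<Sum>s\<in>?S. \<Sum>a\<in>?A. x s a (Suc t))
      = (\<Sum>s\<in>?S. \<Sum>s'\<in>?S. \<Sum>a'\<in>?A. pmf (kernel B i s' a') s * x s' a' t)"
  proof (rule sum.cong)
    fix s assume s: "s \<in> ?S"
    have "\<forall>s\<in>?S. \<forall>t\<in>{1..<horizon B}. (\<Sum>a\<in>?A. x s a t) =
        (\<Sum>s'\<in>?S. \<Sum>a'\<in>?A. pmf (kernel B i s' a') s * x s' a' (t - 1))"
      using x unfolding arm_polytope_def by blast
    from this[rule_format, OF s, of "Suc t"] Suc.prems
    show "(\<Sum>a\<in>?A. x s a (Suc t)) = (\<Sum>s'\<in>?S. \<Sum>a'\<in>?A. pmf (kernel B i s' a') s * x s' a' t)"
      by simp
  qed simp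
  also have "\<dots> = (\<Sum>s'\<in>?S. \<Sum>a'\<in>?A. \<Sum>s\<in>?S. pmf (kernel B i s' a') s * x s' a' t)"
    by (subst sum.swap) (intro sum.cong refl sum.swap)
  also have "\<dots> = (\<Sum>s'\<in>?S. \<Sum>a'\<in>?A. x s' a' t)"
    using arm_facts[OF i] by (intro sum.cong refl) (simp add: sum_distrib_right[symmetric] sum_pmf_eq_1)
  finally show ?case using Suc by simp
qed

lemma arm_active_time_eq:
  assumes i: "i \<in> arms B" and x: "x \<in> arm_polytope B \<mu> i"
  shows "arm_active_time B i x
    = (\<Sum>t<horizon B. \<Sum>s\<in>states B i. \<Sum>a\<in>actions B i - {idle B i}. x s a t)"
proof -
  have split: "(\<Sum>a\<in>actions B i - {idle B i}. x s a t)
      = (\<Sum>a\<in>actions B i. x s a t) - x s (idle B i) t" for s t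
    using arm_facts[OF i] by (simp add: sum_diff1)
  have "(\<Sum>t<horizon B. \<Sum>s\<in>states B i. \<Sum>a\<in>actions B i. x s a t) = real (horizon B)"
    using arm_polytope_mass[OF i x] by simp
  moreover have "(\<Sum>s\<in>states B i. \<Sum>t<horizon B. x s (idle B i) t)
      = (\<Sum>t<horizon B. \<Sum>s\<in>states B i. x s (idle B i) t)"
    by (rule sum.swap)
  ultimately show ?thesis
    unfolding arm_active_time_def split sum_subtractf by simp
qed

lemma arm_active_time_nonneg:
  assumes "i \<in> arms B" "x \<in> arm_polytope B \<mu> i"
  shows "0 \<le> arm_active_time B i x"
  unfolding arm_active_time_eq[OF assms]
  using assms(2) by (intro sum_nonneg) (auto simp: arm_polytope_def)

lemma finite_rewards:
  "finite {reward B i s a | i s a. i \<in> arms B \<and> s \<in> states B i \<and> a \<in> actions B i}"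
proof -
  have "{reward B i s a | i s a. i \<in> arms B \<and> s \<in> states B i \<and> a \<in> actions B i}
      = (\<Union>i\<in>arms B. \<Union>s\<in>states B i. (\<lambda>a. reward B i s a) ` actions B i)"
    by auto
  then show ?thesis using finite_arms arm_facts by simp
qed

lemma reward_le_max_reward:
  assumes "i \<in> arms B" "s \<in> states B i" "a \<in> actions B i"
  shows "reward B i s a \<le> max_reward B"
  unfolding max_reward_def by (rule Max_ge[OF finite_rewards]) (use assms in blast)

lemma max_reward_nonneg: "0 \<le> max_reward B"
proof -
  have i: "1 \<in> arms B"
    using instance_B unfolding bandit_instance_def arms_def by simp
  have "states B 1 \<noteq> {}"
    using arm_initial_mass[OF i] by auto
  then obtain s where s: "s \<in> states B 1" by blast
  show ?thesis
    using reward_le_max_reward[OF i s arm_facts(3)[OF i]] arm_facts(4)[OF i s] by simp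
qed

text \<open>Idle mass earns nothing, so only active time can be rewarded.\<close>

lemma arm_reward_le:
  assumes i: "i \<in> arms B" and x: "x \<in> arm_polytope B \<mu> i"
  shows "arm_reward B i x \<le> max_reward B * arm_active_time B i x"
proof -
  have "(\<Sum>a\<in>actions B i. x s a t * reward B i s a)
      \<le> max_reward B * (\<Sum>a\<in>actions B i - {idle B i}. x s a t)"
    if "s \<in> states B i" "t < horizon B" for s t
  proof -
    have "(\<Sum>a\<in>actions B i. x s a t * reward B i s a)
        = (\<Sum>a\<in>actions B i - {idle B i}. x s a t * reward B i s a)"
      using that arm_facts[OF i] by (subst sum.remove[of _ "idle B i"]) auto
    also have "\<dots> \<le> (\<Sum>a\<in>actions B i - {idle B i}. x s a t * max_reward B)"
      using that x i by (intro sum_mono mult_left_mono reward_le_max_reward) (auto simp: arm_polytope_def)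
    finally show ?thesis
      by (simp add: sum_distrib_left mult.commute)
  qed
  then show ?thesis
    unfolding arm_reward_def arm_active_time_eq[OF i x] sum_distrib_left[of "max_reward B"]
    by (intro sum_mono) (simp add: sum_distrib_left)
qed

text \<open>
  Idling throughout keeps the initial distribution of the arm for all periods. It shows that
  the polytope is nonempty, and it is the competitor of value zero at prohibitive prices.
\<close>

definition idle_policy :: "nat \<Rightarrow> ('s, 'a) arm_policy" where
  "idle_policy i = (\<lambda>s a t.
     if s \<in> states B i \<and> a = idle B i \<and> t < horizon B
     then (\<Sum>s'\<in>{s'\<in>joint_states B. s' i = s}. pmf \<mu> s') else 0)"

lemma sum_idle_policy:
  assumes i: "i \<in> arms B" and "s \<in> states B i" "t < horizon B"
  shows "(\<Sum>a\<in>actions B i. f a * idle_policy i s a t)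
    = f (idle B i) * (\<Sum>s'\<in>{s'\<in>joint_states B. s' i = s}. pmf \<mu> s')"
proof -
  have "(\<Sum>a\<in>actions B i. f a * idle_policy i s a t)
      = (\<Sum>a\<in>actions B i. if a = idle B i
           then f a * (\<Sum>s'\<in>{s'\<in>joint_states B. s' i = s}. pmf \<mu> s') else 0)"
    using assms by (intro sum.cong) (auto simp: idle_policy_def)
  then show ?thesis
    using arm_facts[OF i] by (simp add: sum.delta)
qed

lemma idle_kernel:
  assumes "i \<in> arms B" "s' \<in> states B i"
  shows "pmf (kernel B i s' (idle B i)) s = (if s = s' then 1 else 0)"
proof -
  (* The mass one at s' leaves nothing for any other state. *)
  have "(\<Sum>u\<in>{s, s'}. pmf (kernel B i s' (idle B i)) u) \<le> 1"
    by (simp add: measure_measure_pmf_finite[symmetric])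
  then show ?thesis
    using arm_facts(6)[OF assms] pmf_nonneg[of "kernel B i s' (idle B i)" s] by (cases "s = s'") auto
qed

lemma idle_policy_in_arm_polytope:
  assumes i: "i \<in> arms B"
  shows "idle_policy i \<in> arm_polytope B \<mu> i"
proof -
  have T: "0 < horizon B"
    using instance_B unfolding bandit_instance_def by simp
  show ?thesis
    unfolding arm_polytope_def
  proof (intro CollectI conjI ballI allI impI)
    fix s a t assume "s \<notin> states B i \<or> a \<notin> actions B i \<or> t \<ge> horizon B"
    then show "idle_policy i s a t = 0"
      using arm_facts[OF i] by (auto simp: idle_policy_def)
  next
    fix s a t
    show "0 \<le> idle_policy i s a t"
      by (auto simp: idle_policy_def intro: sum_nonneg)
  next
    fix s t assume s: "s \<in> states B i" and t: "t \<in> {1..<horizon B}"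
    have t': "t < horizon B" "t - 1 < horizon B" using t by auto
    let ?m = "\<lambda>s. \<Sum>s'\<in>{s'\<in>joint_states B. s' i = s}. pmf \<mu> s'"
    have "(\<Sum>s'\<in>states B i. \<Sum>a'\<in>actions B i. pmf (kernel B i s' a') s * idle_policy i s' a' (t - 1))
        = (\<Sum>s'\<in>states B i. if s = s' then ?m s' else 0)"
    proof (rule sum.cong)
      fix s' assume s': "s' \<in> states B i"
      show "(\<Sum>a'\<in>actions B i. pmf (kernel B i s' a') s * idle_policy i s' a' (t - 1))
          = (if s = s' then ?m s' else 0)"
        unfolding sum_idle_policy[OF i s' t'(2), of "\<lambda>a'. pmf (kernel B i s' a') s"] idle_kernel[OF i s']
        by simp
    qed simp
    also have "\<dots> = ?m s"
      using s arm_facts(1)[OF i] by (simp only: sum.delta' if_True)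
    also have "\<dots> = (\<Sum>a\<in>actions B i. idle_policy i s a t)"
      using sum_idle_policy[OF i s t'(1), of "\<lambda>_. 1"] by simp
    finally show "(\<Sum>a\<in>actions B i. idle_policy i s a t) =
        (\<Sum>s'\<in>states B i. \<Sum>a'\<in>actions B i. pmf (kernel B i s' a') s * idle_policy i s' a' (t - 1))"
      by simp
  next
    fix s assume "s \<in> states B i"
    then show "(\<Sum>a\<in>actions B i. idle_policy i s a 0) = (\<Sum>s'\<in>{s'\<in>joint_states B. s' i = s}. pmf \<mu> s')"
      using sum_idle_policy[OF i _ T, of s "\<lambda>_. 1"] by simp
  qed
qed

lemma idle_policy_value:
  assumes i: "i \<in> arms B"
  shows "arm_reward B i (idle_policy i) = 0" "arm_active_time B i (idle_policy i) = 0"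
proof -
  show "arm_reward B i (idle_policy i) = 0"
    unfolding arm_reward_def using arm_facts(4)[OF i]
    by (intro sum.neutral ballI) (auto simp: idle_policy_def)
  show "arm_active_time B i (idle_policy i) = 0"
    unfolding arm_active_time_eq[OF i idle_policy_in_arm_polytope[OF i]]
    by (intro sum.neutral ballI) (auto simp: idle_policy_def)
qed

section \<open>Existence of Lagrangian maximizers\<close>

text \<open>
  Policies carry the product topology, in which every coordinate is continuous.
\<close>

lemma continuous_on_policy_coordinate [continuous_intros]:
  "continuous_on S (\<lambda>x :: ('s, 'a) arm_policy. x s a t)"
  by (rule continuous_on_product_then_coordinatewise[OF continuous_on_product_then_coordinatewise[OF
        continuous_on_product_then_coordinatewise[OF continuous_on_id]]])

text \<open>
  Every coordinate is bounded by the total mass one of its period, and the flow constraints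
  are closed conditions. Compactness of the surrounding cube is Tychonoff's theorem.
\<close>

lemma compact_arm_polytope:
  assumes i: "i \<in> arms B"
  shows "compact (arm_polytope B \<mu> i)"
proof -
  let ?cube = "{x :: ('s, 'a) arm_policy. \<forall>s a t. x s a t \<in> {0..1}}"
  have "compact ?cube"
    using compact_functions_into[OF compact_functions_into[OF compact_functions_into[OF
          compact_Icc[of "0 :: real" 1]]]]
    by simp
  moreover have "closed (arm_polytope B \<mu> i)"
    unfolding arm_polytope_def Ball_def
    by (intro closed_Collect_conj closed_Collect_all closed_Collect_imp closed_Collect_eq
        closed_Collect_le continuous_intros open_Collect_const)
  moreover have "arm_polytope B \<mu> i \<subseteq> ?cube"
  proof (intro subsetI CollectI allI)
    fix x s a t assume x: "x \<in> arm_polytope B \<mu> i"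
    have nonneg: "0 \<le> x s a t" for s a t
      using x unfolding arm_polytope_def by (cases "s \<in> states B i \<and> a \<in> actions B i \<and> t < horizon B") auto
    show "x s a t \<in> {0..1}"
    proof (cases "s \<in> states B i \<and> a \<in> actions B i \<and> t < horizon B")
      case True
      have "x s a t \<le> (\<Sum>a\<in>actions B i. x s a t)"
        using True arm_facts[OF i] nonneg by (intro member_le_sum) auto
      also have "\<dots> \<le> (\<Sum>s\<in>states B i. \<Sum>a\<in>actions B i. x s a t)"
        using True arm_facts[OF i] nonneg
        by (intro member_le_sum[where f = "\<lambda>s. \<Sum>a\<in>actions B i. x s a t"] sum_nonneg) auto
      finally show ?thesis
        using True nonneg arm_polytope_mass[OF i x] by simp
    next
      case False
      then have "x s a t = 0" using x unfolding arm_polytope_def by auto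
      then show ?thesis by simp
    qed
  qed
  ultimately show ?thesis
    using compact_Int_closed[of ?cube "arm_polytope B \<mu> i"] by (simp add: Int_absorb1)
qed

lemma ex_lagrangian_maximizer: "\<exists>\<pi>. lagrangian_maximizer B \<mu> l \<pi>"
proof -
  have "\<exists>x. is_arg_max (\<lambda>x. arm_reward B i x - l * arm_active_time B i x)
      (\<lambda>x. x \<in> arm_polytope B \<mu> i) x" if i: "i \<in> arms B" for i
  proof -
    have "continuous_on (arm_polytope B \<mu> i) (\<lambda>x. arm_reward B i x - l * arm_active_time B i x)"
      unfolding arm_reward_def arm_active_time_def by (intro continuous_intros)
    moreover have "arm_polytope B \<mu> i \<noteq> {}"
      using idle_policy_in_arm_polytope[OF i] by blast
    ultimately show ?thesis
      using continuous_attains_sup[OF compact_arm_polytope[OF i]]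
      unfolding is_arg_max_def by (meson not_less)
  qed
  then show ?thesis
    unfolding lagrangian_maximizer_def by metis
qed

section \<open>The bisection\<close>

lemma lagrangian_maximizerD:
  assumes "lagrangian_maximizer B \<mu> l \<pi>" "i \<in> arms B"
  shows "\<pi> i \<in> arm_polytope B \<mu> i"
    and "\<And>x. x \<in> arm_polytope B \<mu> i \<Longrightarrow>
      arm_reward B i x - l * arm_active_time B i x
        \<le> arm_reward B i (\<pi> i) - l * arm_active_time B i (\<pi> i)"
  using assms unfolding lagrangian_maximizer_def is_arg_max_def by (auto simp: not_less)

text \<open>Weak duality: the price \<open>l\<close> is charged on a budget that \<open>\<rho>\<close> does not exceed.\<close>

lemma lagrangian_bound:
  assumes \<pi>: "lagrangian_maximizer B \<mu> l \<pi>" and "0 \<le> l" and \<rho>: "rlp_feasible B \<mu> \<rho>"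
  shows "total_reward B \<rho> - l * budget B \<le> total_reward B \<pi> - l * total_active_time B \<pi>"
proof -
  have "l * total_active_time B \<rho> \<le> l * budget B"
    using assms by (intro mult_left_mono) (auto simp: rlp_feasible_def)
  moreover have "total_reward B \<rho> - l * total_active_time B \<rho>
      \<le> total_reward B \<pi> - l * total_active_time B \<pi>"
    unfolding total_reward_def total_active_time_def sum_distrib_left sum_subtractf[symmetric]
    using \<rho> by (intro sum_mono lagrangian_maximizerD[OF \<pi>]) (auto simp: rlp_feasible_def)
  ultimately show ?thesis by linarith
qed

text \<open>
  The loop invariant. The lower policy need not overspend as long as the lower price is still
  at its initial value zero.
\<close>

definition bracketing :: "('s, 'a) solver_state \<Rightarrow> bool" where
  "bracketing \<sigma> \<longleftrightarrow>
     lagrangian_maximizer B \<mu> (lam_feas \<sigma>) (pol_feas \<sigma>) \<and>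
     lagrangian_maximizer B \<mu> (lam_infeas \<sigma>) (pol_infeas \<sigma>) \<and>
     total_active_time B (pol_feas \<sigma>) \<le> budget B \<and>
     (lam_infeas \<sigma> = 0 \<or> budget B < total_active_time B (pol_infeas \<sigma>)) \<and>
     0 \<le> lam_infeas \<sigma> \<and> lam_infeas \<sigma> \<le> lam_feas \<sigma>"

text \<open>
  Activation costs more than it can ever earn at the initial upper price, while idling
  throughout has Lagrangian value zero.
\<close>

lemma bracketing_init:
  assumes "solver_init B \<mu> \<delta> \<sigma>" "0 < \<delta>"
  shows "bracketing \<sigma>"
proof -
  let ?l = "max_reward B + \<delta>"
  have lf: "lam_feas \<sigma> = ?l" and f: "lagrangian_maximizer B \<mu> ?l (pol_feas \<sigma>)"
    using assms unfolding solver_init_def by auto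
  have "arm_active_time B i (pol_feas \<sigma> i) \<le> 0" if i: "i \<in> arms B" for i
  proof -
    let ?x = "pol_feas \<sigma> i"
    have "0 \<le> arm_reward B i ?x - ?l * arm_active_time B i ?x"
      using lagrangian_maximizerD(2)[OF f i idle_policy_in_arm_polytope[OF i]]
      by (simp add: idle_policy_value[OF i])
    also have "\<dots> \<le> - \<delta> * arm_active_time B i ?x"
      using arm_reward_le[OF i lagrangian_maximizerD(1)[OF f i]] by (simp add: algebra_simps)
    finally show ?thesis
      using \<open>0 < \<delta>\<close> by (simp add: mult_le_0_iff)
  qed
  then have "total_active_time B (pol_feas \<sigma>) \<le> 0"
    unfolding total_active_time_def by (intro sum_nonpos)
  then show ?thesis
    using assms f budget_pos max_reward_nonneg unfolding bracketing_def solver_init_def by auto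
qed

lemma solver_stepE:
  assumes "solver_step B \<mu> \<epsilon> \<sigma> \<sigma>'"
  obtains l \<pi> where "l = (lam_feas \<sigma> + lam_infeas \<sigma>) / 2" "lagrangian_maximizer B \<mu> l \<pi>"
      "budget B < total_active_time B \<pi>" "\<sigma>' = \<sigma>\<lparr>lam_infeas := l, pol_infeas := \<pi>\<rparr>"
    | l \<pi> where "l = (lam_feas \<sigma> + lam_infeas \<sigma>) / 2" "lagrangian_maximizer B \<mu> l \<pi>"
      "total_active_time B \<pi> \<le> budget B" "\<sigma>' = \<sigma>\<lparr>lam_feas := l, pol_feas := \<pi>\<rparr>"
  using assms unfolding solver_step_def by (metis not_less)

lemma bracketing_step:
  assumes "bracketing \<sigma>" "solver_step B \<mu> \<epsilon> \<sigma> \<sigma>'"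
  shows "bracketing \<sigma>'"
  using assms(2) by (cases rule: solver_stepE) (use assms(1) in \<open>auto simp: bracketing_def\<close>)

lemma reachable_bracketing:
  assumes "solver_reachable B \<mu> \<epsilon> \<sigma>"
  shows "bracketing \<sigma>"
proof -
  obtain \<delta> \<sigma>0 where "0 < \<delta>" "solver_init B \<mu> \<delta> \<sigma>0" and "(solver_step B \<mu> \<epsilon>)\<^sup>*\<^sup>* \<sigma>0 \<sigma>"
    using assms unfolding solver_reachable_def by blast
  from this(3) show ?thesis
    by (induction rule: rtranclp_induct)
      (use bracketing_init[OF \<open>solver_init B \<mu> \<delta> \<sigma>0\<close> \<open>0 < \<delta>\<close>] bracketing_step in blast)+
qed

lemma solver_step_halves_gap:
  assumes "solver_step B \<mu> \<epsilon> \<sigma> \<sigma>'"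
  shows "lam_feas \<sigma>' - lam_infeas \<sigma>' = (lam_feas \<sigma> - lam_infeas \<sigma>) / 2"
  using assms by (cases rule: solver_stepE) (simp; linarith)+

lemma no_infinite_run:
  assumes "0 < \<epsilon>" and run: "\<And>m :: nat. solver_step B \<mu> \<epsilon> (f m) (f (Suc m))"
  shows False
proof -
  define gap where "gap m = lam_feas (f m) - lam_infeas (f m)" for m
  have half: "gap (Suc m) = gap m / 2" for m
    unfolding gap_def by (rule solver_step_halves_gap[OF run])
  have gap: "gap m = gap 0 * (1 / 2) ^ m" for m
    by (induction m) (simp_all add: half)
  have "(\<lambda>m. gap 0 * (1 / 2) ^ m) \<longlonglongrightarrow> gap 0 * 0"
    by (intro tendsto_intros LIMSEQ_power_zero) simp
  then have "(\<lambda>m. gap 0 * (1 / 2) ^ m) \<longlonglongrightarrow> 0" by simp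
  moreover have "0 < \<epsilon> / budget B" using assms budget_pos by simp
  ultimately have "eventually (\<lambda>m. gap 0 * (1 / 2) ^ m < \<epsilon> / budget B) sequentially"
    by (rule order_tendstoD(2))
  then obtain m where "gap 0 * (1 / 2) ^ m < \<epsilon> / budget B"
    unfolding eventually_sequentially by blast
  then have "gap m < \<epsilon> / budget B" using gap[of m] by linarith
  moreover have "gap m > \<epsilon> / budget B"
    using run[of m] unfolding solver_step_def solver_guard_def gap_def by blast
  ultimately show False by simp
qed

lemma solver_terminates:
  assumes "0 < \<epsilon>"
  shows "solver_terminates B \<mu> \<epsilon>"
  unfolding solver_terminates_def
proof (intro conjI allI impI)
  fix \<delta> :: real
  obtain \<pi> \<rho> where "lagrangian_maximizer B \<mu> (max_reward B + \<delta>) \<pi>" "lagrangian_maximizer B \<mu> 0 \<rho>"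
    using ex_lagrangian_maximizer by blast
  then have "solver_init B \<mu> \<delta>
      \<lparr>lam_feas = max_reward B + \<delta>, lam_infeas = 0, pol_feas = \<pi>, pol_infeas = \<rho>\<rparr>"
    unfolding solver_init_def by simp
  then show "\<exists>\<sigma>. solver_init B \<mu> \<delta> \<sigma>" by blast
next
  fix \<sigma> assume "solver_reachable B \<mu> \<epsilon> \<sigma> \<and> solver_guard B \<epsilon> \<sigma>"
  then show "\<exists>\<sigma>'. solver_step B \<mu> \<epsilon> \<sigma> \<sigma>'"
    unfolding solver_step_def using ex_lagrangian_maximizer by blast
next
  show "\<not> (\<exists>f. (\<exists>\<delta>>0. solver_init B \<mu> \<delta> (f 0)) \<and> (\<forall>m::nat. solver_step B \<mu> \<epsilon> (f m) (f (Suc m))))"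
    using no_infinite_run[OF assms] by blast
qed

section \<open>Quality of the output\<close>

lemma solver_output_correct:
  assumes br: "bracketing \<sigma>" and stop: "\<not> solver_guard B \<epsilon> \<sigma>"
  shows "rlp_feasible B \<mu> (solver_output B \<sigma>)"
    and "rlp_feasible B \<mu> \<rho> \<Longrightarrow> total_reward B \<rho> - \<epsilon> \<le> total_reward B (solver_output B \<sigma>)"
proof -
  define w where "w = solver_weight B \<sigma>"
  let ?f = "pol_feas \<sigma>" and ?h = "pol_infeas \<sigma>"
  let ?Af = "total_active_time B ?f" and ?Ah = "total_active_time B ?h"
  have f: "lagrangian_maximizer B \<mu> (lam_feas \<sigma>) ?f"
    and h: "lagrangian_maximizer B \<mu> (lam_infeas \<sigma>) ?h"
    and inv: "?Af \<le> budget B" "lam_infeas \<sigma> = 0 \<or> budget B < ?Ah"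
      "0 \<le> lam_infeas \<sigma>" "lam_infeas \<sigma> \<le> lam_feas \<sigma>"
    using br unfolding bracketing_def by auto
  have out: "solver_output B \<sigma> i = mix w (?h i) (?f i)" for i
    unfolding solver_output_def mix_def w_def by simp
  have R: "total_reward B (solver_output B \<sigma>) = w * total_reward B ?h + (1 - w) * total_reward B ?f"
    unfolding total_reward_def out arm_reward_mix by (simp add: sum.distrib sum_distrib_left)
  have A: "total_active_time B (solver_output B \<sigma>) = w * ?Ah + (1 - w) * ?Af"
    unfolding total_active_time_def out arm_active_time_mix by (simp add: sum.distrib sum_distrib_left)
  have Af0: "0 \<le> ?Af"
    unfolding total_active_time_def
    by (intro sum_nonneg arm_active_time_nonneg lagrangian_maximizerD(1)[OF f])
  have gap: "(lam_feas \<sigma> - lam_infeas \<sigma>) * budget B \<le> \<epsilon>"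
    using stop budget_pos unfolding solver_guard_def by (simp add: field_simps)
  have w: "w = (if ?Ah - ?Af > 0 then min ((budget B - ?Af) / (?Ah - ?Af)) 1 else 0)"
    unfolding w_def solver_weight_def Let_def sum_subtractf total_active_time_def by simp
  note loss = interpolation_loss[OF Af0 inv(1,3,4) gap inv(2) _ _ w]
  have lam0: "0 \<le> lam_feas \<sigma>" using inv by linarith
  (* The bounds on the weight do not refer to v; a small enough v satisfies the premises. *)
  define v where "v = min (total_reward B ?f - lam_feas \<sigma> * ?Af + lam_feas \<sigma> * budget B)
      (total_reward B ?h - lam_infeas \<sigma> * ?Ah + lam_infeas \<sigma> * budget B)"
  have v: "v - lam_feas \<sigma> * budget B \<le> total_reward B ?f - lam_feas \<sigma> * ?Af"
    "v - lam_infeas \<sigma> * budget B \<le> total_reward B ?h - lam_infeas \<sigma> * ?Ah"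
    unfolding v_def by linarith+
  note bounds = loss(1-3)[OF v]
  show "rlp_feasible B \<mu> (solver_output B \<sigma>)"
    unfolding rlp_feasible_def A out
    using bounds by (auto intro!: mix_in_arm_polytope lagrangian_maximizerD(1)[OF f]
        lagrangian_maximizerD(1)[OF h])
  assume \<rho>: "rlp_feasible B \<mu> \<rho>"
  show "total_reward B \<rho> - \<epsilon> \<le> total_reward B (solver_output B \<sigma>)"
    unfolding R
    by (rule loss(4)[OF lagrangian_bound[OF f lam0 \<rho>] lagrangian_bound[OF h inv(3) \<rho>]])
qed

end

theorem theorem2:
  fixes B :: "('s, 'a) bandit" and \<mu> :: "(nat \<Rightarrow> 's) pmf" and \<epsilon> :: real
  assumes "bandit_instance B"
    and "initial_distribution B \<mu>"
    and "\<epsilon> > 0"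
  shows "solver_terminates B \<mu> \<epsilon> \<and>
         (\<forall>\<pi>. solver_result B \<mu> \<epsilon> \<pi> \<longrightarrow>
            rlp_feasible B \<mu> \<pi> \<and>
            ereal (total_reward B \<pi>) \<ge> rlp_opt B \<mu> - ereal (2 * \<epsilon>))"
proof -
  interpret rlp_instance B \<mu>
    using assms by unfold_locales
  have "rlp_feasible B \<mu> \<pi> \<and> ereal (total_reward B \<pi>) \<ge> rlp_opt B \<mu> - ereal (2 * \<epsilon>)"
    if result: "solver_result B \<mu> \<epsilon> \<pi>" for \<pi>
  proof
    obtain \<sigma> where "bracketing \<sigma>" "\<not> solver_guard B \<epsilon> \<sigma>" and \<pi>: "\<pi> = solver_output B \<sigma>"
      using result reachable_bracketing unfolding solver_result_def by blast
    note correct = solver_output_correct[OF this(1,2), folded \<pi>]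
    show "rlp_feasible B \<mu> \<pi>" by (rule correct)
    have "total_reward B \<rho> \<le> total_reward B \<pi> + 2 * \<epsilon>" if "rlp_feasible B \<mu> \<rho>" for \<rho>
      using correct(2)[OF that] \<open>\<epsilon> > 0\<close> by linarith
    then have "rlp_opt B \<mu> \<le> ereal (total_reward B \<pi> + 2 * \<epsilon>)"
      unfolding rlp_opt_def by (intro SUP_least) auto
    then show "rlp_opt B \<mu> - ereal (2 * \<epsilon>) \<le> ereal (total_reward B \<pi>)"
      by (cases "rlp_opt B \<mu>") auto
  qed
  then show ?thesis
    using solver_terminates[OF assms(3)] by blast
qed

end
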